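(* Let $\mathcal{H}_{d} \subset \mathbb{P}^{2}$ be a Hirzebruch's quasipencil of $d \geq 3$ lines in the complex projective plane. Then $$\varepsilon(\mathbb{P}^{2}, \mathcal{O}_{\mathbb{P}^{2}}(1); \mathrm{Sing}(\mathcal{H}_{d})) = \frac{1}{d-1}.$$
   Context: We work over the complex numbers. A line arrangement is a finite set of distinct lines in $\mathbb{P}^2$; its singular locus $\mathrm{Sing}$ is the set of points lying on at least two lines of the arrangement, and the multiplicity of a singular point is the number of lines of the arrangement through it. An arrangement $\mathcal{H}_d=\{\ell_1,\dots,\ell_d\}$ of $d \geq 3$ lines is called Hirzebruch's quasipencil if its singular locus consists of one point of multiplicity $d-1$ and $d-1$ double points; one may label the lines so that the point of multiplicity $d-1$ is the intersection of $\ell_1,\dots,\ell_{d-1}$. (For $d=3$ this means three lines meeting in exactly three double points.) For a finite set of points $\mathcal{P}=\{p_1,\dots,p_r\}\subset\mathbb{P}^2$, the multi-point Seshadri constant is $$\varepsilon(\mathbb{P}^{2}, \mathcal{O}_{\mathbb{P}^{2}}(1); \mathcal{P}) = \inf_{C \cap \mathcal{P} \neq \emptyset} \frac{\deg C}{\sum_{i=1}^{r} \mathrm{mult}_{p_{i}} C},$$ where the infimum is over all irreducible and reduced curves $C \subset \mathbb{P}^2$ passing through at least one point of $\mathcal{P}$. *)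

theory Defs
  imports "HOL-Analysis.Analysis" "HOL-Library.Poly_Mapping"
    "HOL-Computational_Algebra.Factorial_Ring"
begin

definition proj_rel :: "complex ^ 3 \<Rightarrow> complex ^ 3 \<Rightarrow> bool" where
  "proj_rel u v \<longleftrightarrow> u \<noteq> 0 \<and> v \<noteq> 0 \<and> (\<exists>c. c \<noteq> 0 \<and> v = c *s u)"

lemma part_equivp_proj_rel: "part_equivp proj_rel"
proof (rule part_equivpI)
  have "proj_rel (axis 1 1) (axis 1 1)"
    by (auto simp: proj_rel_def axis_eq_0_iff intro!: exI[of _ 1])
  then show "\<exists>x. proj_rel x x" ..
  show "symp proj_rel"
  proof (rule sympI)
    fix u v assume "proj_rel u v"
    then obtain c where c: "u \<noteq> 0" "v \<noteq> 0" "c \<noteq> 0" "v = c *s u"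
      by (auto simp: proj_rel_def)
    then have "u = inverse c *s v"
      by (simp add: vector_smult_assoc)
    with c show "proj_rel v u"
      unfolding proj_rel_def by (metis inverse_nonzero_iff_nonzero)
  qed
  show "transp proj_rel"
  proof (rule transpI)
    fix u v w assume uv: "proj_rel u v" and vw: "proj_rel v w"
    from uv vw obtain c e where "u \<noteq> 0" "w \<noteq> 0" "c \<noteq> 0" "e \<noteq> 0" "v = c *s u" "w = e *s v"
      by (auto simp: proj_rel_def)
    then show "proj_rel u w"
      unfolding proj_rel_def by (metis mult_eq_0_iff vector_smult_assoc)
  qed
qed

quotient_type proj_plane = "complex ^ 3" / partial: proj_rel
  by (rule part_equivp_proj_rel)

text \<open>The point with homogeneous coordinates \<open>v\<close>; meaningful only for \<open>v \<noteq> 0\<close>.\<close>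

definition point :: "complex ^ 3 \<Rightarrow> proj_plane" where
  "point v = abs_proj_plane v"

lemma point_eq_iff:
  assumes "u \<noteq> 0" "v \<noteq> 0"
  shows "point u = point v \<longleftrightarrow> (\<exists>c. c \<noteq> 0 \<and> v = c *s u)"
proof -
  have refl: "proj_rel w w" if "w \<noteq> 0" for w
    using that by (auto simp: proj_rel_def intro!: exI[of _ 1])
  have "point u = point v \<longleftrightarrow> proj_rel u v"
    unfolding point_def
    using Quotient3_rel[OF Quotient3_proj_plane, of u v] refl assms by blast
  then show ?thesis
    using assms by (simp add: proj_rel_def)
qed

lemma ex_point: "\<exists>v. v \<noteq> 0 \<and> p = point v"
proof -
  have "proj_rel (rep_proj_plane p) (rep_proj_plane p)"
    by (rule Quotient3_rep_reflp[OF Quotient3_proj_plane])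
  moreover have "p = point (rep_proj_plane p)"
    unfolding point_def by (rule Quotient3_abs_rep[OF Quotient3_proj_plane, symmetric])
  ultimately show ?thesis
    by (auto simp: proj_rel_def)
qed

definition line :: "complex ^ 3 \<Rightarrow> proj_plane set" where
  "line a = {point v | v. v \<noteq> 0 \<and> (\<Sum>i\<in>UNIV. a $ i * v $ i) = 0}"

definition line_arrangement :: "proj_plane set set \<Rightarrow> bool" where
  "line_arrangement H \<longleftrightarrow> finite H \<and> (\<forall>l\<in>H. \<exists>a. a \<noteq> 0 \<and> l = line a)"

definition arr_mult :: "proj_plane set set \<Rightarrow> proj_plane \<Rightarrow> nat" where
  "arr_mult H p = card {l \<in> H. p \<in> l}"

definition Sing :: "proj_plane set set \<Rightarrow> proj_plane set" where
  "Sing H = {p. arr_mult H p \<ge> 2}"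

text \<open>For three lines \<open>card H - 1 = 2\<close>, so the distinguished point \<open>p\<close> is itself a double point
  and the condition says that there are exactly three double points.\<close>

definition hirzebruch_quasipencil :: "proj_plane set set \<Rightarrow> bool" where
  "hirzebruch_quasipencil H \<longleftrightarrow>
     line_arrangement H \<and> card H \<ge> 3 \<and>
     (\<exists>p\<in>Sing H. arr_mult H p = card H - 1 \<and>
        card (Sing H - {p}) = card H - 1 \<and>
        (\<forall>q\<in>Sing H - {p}. arr_mult H q = 2))"

text \<open>The polynomial ring in three variables over the complex numbers: a polynomial maps each
  exponent vector to its coefficient.\<close>

type_synonym cpoly3 = "(3 \<Rightarrow>\<^sub>0 nat) \<Rightarrow>\<^sub>0 complex"

definition const :: "complex \<Rightarrow> cpoly3" where
  "const c = Poly_Mapping.single 0 c"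

definition Var :: "3 \<Rightarrow> cpoly3" where
  "Var i = Poly_Mapping.single (Poly_Mapping.single i 1) 1"

definition mon_deg :: "(3 \<Rightarrow>\<^sub>0 nat) \<Rightarrow> nat" where
  "mon_deg m = (\<Sum>i\<in>UNIV. Poly_Mapping.lookup m i)"

definition homogeneous :: "cpoly3 \<Rightarrow> bool" where
  "homogeneous F \<longleftrightarrow> (\<exists>n. \<forall>m\<in>Poly_Mapping.keys F. mon_deg m = n)"

text \<open>Junk value for \<open>F = 0\<close> here and in \<open>ord0\<close> below.\<close>

definition deg :: "cpoly3 \<Rightarrow> nat" where
  "deg F = Max (mon_deg ` Poly_Mapping.keys F)"

definition poly_eval :: "cpoly3 \<Rightarrow> complex ^ 3 \<Rightarrow> complex" where
  "poly_eval F v = (\<Sum>m\<in>Poly_Mapping.keys F.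
     Poly_Mapping.lookup F m * (\<Prod>i\<in>UNIV. (v $ i) ^ Poly_Mapping.lookup m i))"

definition poly_subst :: "cpoly3 \<Rightarrow> (3 \<Rightarrow> cpoly3) \<Rightarrow> cpoly3" where
  "poly_subst F g = (\<Sum>m\<in>Poly_Mapping.keys F.
     const (Poly_Mapping.lookup F m) * (\<Prod>i\<in>UNIV. g i ^ Poly_Mapping.lookup m i))"

text \<open>An irreducible and reduced plane curve is given by an irreducible form, unique up to a
  nonzero scalar; degree, zero locus and multiplicities do not depend on that scalar.\<close>

definition integral_curve :: "cpoly3 \<Rightarrow> bool" where
  "integral_curve F \<longleftrightarrow> homogeneous F \<and> irreducible F"

definition zero_locus :: "cpoly3 \<Rightarrow> proj_plane set" where
  "zero_locus F = {point v | v. v \<noteq> 0 \<and> poly_eval F v = 0}"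

text \<open>For \<open>v $ i = 1\<close>: the dehomogenization of \<open>F\<close> in the affine chart \<open>x\<^sub>i = 1\<close>, translated so
  that \<open>point v\<close> becomes the origin. It does not involve the variable \<open>Var i\<close>.\<close>

definition local_equation :: "cpoly3 \<Rightarrow> complex ^ 3 \<Rightarrow> 3 \<Rightarrow> cpoly3" where
  "local_equation F v i =
     poly_subst F (\<lambda>j. if j = i then 1 else const (v $ j) + Var j)"

text \<open>The least degree of a monomial of \<open>f\<close>, i.e. the multiplicity of \<open>f = 0\<close> at the origin.\<close>

definition ord0 :: "cpoly3 \<Rightarrow> nat" where
  "ord0 f = Min (mon_deg ` Poly_Mapping.keys f)"

text \<open>For nonzero homogeneous \<open>F\<close> the value is the same in every chart containing \<open>p\<close>; the
  choice operator only picks one.\<close>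

definition curve_mult :: "proj_plane \<Rightarrow> cpoly3 \<Rightarrow> nat" where
  "curve_mult p F = (SOME m. \<exists>v i. v $ i = 1 \<and> p = point v \<and> m = ord0 (local_equation F v i))"

definition seshadri_P2_O1 :: "proj_plane set \<Rightarrow> real" where
  "seshadri_P2_O1 P =
     Inf {real (deg F) / real (\<Sum>p\<in>P. curve_mult p F) | F.
            integral_curve F \<and> zero_locus F \<inter> P \<noteq> {}}"

end

theory Submission
  imports Defs "HOL-Computational_Algebra.Polynomial"
begin

text \<open>
  Let \<open>p\<close> be the point of multiplicity \<open>d - 1\<close> and let \<open>\<ell>\<close> be the one line of the arrangement that does
  not contain it. The \<open>d - 1\<close> other singular points all lie on \<open>\<ell>\<close>
  (\<open>quasipencil_transversal\<close>). The line \<open>\<ell>\<close> itself has degree 1, passes through these \<open>d - 1\<close> points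
  and misses \<open>p\<close>, so it gives the quotient \<open>1 / (d - 1)\<close>, and it remains to see that no integral
  curve \<open>C\<close> does better: the sum of its multiplicities is at most \<open>(d - 1) deg C\<close>.

  If \<open>C\<close> does not contain \<open>\<ell>\<close>, then by Bezout's theorem the multiplicities at the points on \<open>\<ell>\<close> add up
  to at most \<open>deg C\<close>. Since the multiplicity at \<open>p\<close> is at most \<open>deg C\<close>, the sum over all singular
  points is at most \<open>2 deg C\<close>, and \<open>2 \<le> d - 1\<close>. If \<open>C\<close> contains \<open>\<ell>\<close>, then \<open>C\<close> is \<open>\<ell>\<close> by irreducibility:
  it misses \<open>p\<close>, and at each of the other \<open>d - 1\<close> points the multiplicity is at most \<open>deg C\<close>. Both
  cases are treated in \<open>sum_curve_mult_le_card_times_deg\<close>.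

  Bezout's theorem is needed only for a line and a curve that does not contain it. There it is
  the statement that a nonzero univariate polynomial, the restriction of the equation to the line,
  has at most as many roots as its degree (\<open>sum_curve_mult_le_deg\<close>), together with the fact that
  the order of a root is at least the multiplicity of the curve at the corresponding point
  (\<open>curve_mult_le_order\<close>). The algebraic input is that a ternary polynomial vanishing everywhere is
  zero (\<open>poly_eval_nonzero\<close>), that linear forms are irreducible (\<open>irreducible_linear_form\<close>), and that
  a polynomial vanishing on a line is divisible by the equation of this line
  (\<open>linear_form_dvd\<close>).
\<close>

section \<open>Ternary polynomials as functions\<close>

definition mono_eval :: "complex ^ 3 \<Rightarrow> (3 \<Rightarrow>\<^sub>0 nat) \<Rightarrow> complex" where
  "mono_eval v m = (\<Prod>i\<in>UNIV. (v $ i) ^ Poly_Mapping.lookup m i)"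

lemma mono_eval_0 [simp]: "mono_eval v 0 = 1"
  by (simp add: mono_eval_def)

lemma mono_eval_add: "mono_eval v (m + n) = mono_eval v m * mono_eval v n"
  by (simp add: mono_eval_def lookup_add power_add prod.distrib)

lemma mono_eval_smult: "mono_eval (c *s v) m = c ^ mon_deg m * mono_eval v m"
  by (simp add: mono_eval_def mon_deg_def power_mult_distrib prod.distrib power_sum)

lemma poly_eval_superset:
  assumes "finite S" "Poly_Mapping.keys F \<subseteq> S"
  shows "poly_eval F v = (\<Sum>m\<in>S. Poly_Mapping.lookup F m * mono_eval v m)"
  unfolding poly_eval_def mono_eval_def
  by (rule sum.mono_neutral_left) (use assms in \<open>auto simp: in_keys_iff\<close>)

lemma poly_eval_altdef:
  "poly_eval F v = (\<Sum>m\<in>Poly_Mapping.keys F. Poly_Mapping.lookup F m * mono_eval v m)"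
  by (simp add: poly_eval_def mono_eval_def)

lemma poly_eval_0 [simp]: "poly_eval 0 v = 0"
  by (simp add: poly_eval_def)

lemma poly_eval_single [simp]: "poly_eval (Poly_Mapping.single m c) v = c * mono_eval v m"
  by (simp add: poly_eval_altdef)

lemma poly_eval_1 [simp]: "poly_eval 1 v = 1"
  by (simp add: poly_eval_altdef)

lemma poly_eval_const [simp]: "poly_eval (const c) v = c"
  by (simp add: const_def)

lemma poly_eval_Var [simp]: "poly_eval (Var i) v = v $ i"
proof -
  have "mono_eval v (Poly_Mapping.single i 1) = (\<Prod>j\<in>UNIV. if j = i then v $ j else 1)"
    unfolding mono_eval_def by (intro prod.cong) (auto simp: lookup_single)
  then show ?thesis
    by (simp add: Var_def)
qed

lemma poly_eval_add [simp]: "poly_eval (F + G) v = poly_eval F v + poly_eval G v"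
proof -
  let ?S = "Poly_Mapping.keys F \<union> Poly_Mapping.keys G"
  have "Poly_Mapping.keys (F + G) \<subseteq> ?S" by (rule keys_add)
  then show ?thesis
    by (simp add: poly_eval_superset[of ?S] lookup_add distrib_right sum.distrib)
qed

lemma poly_eval_sum [simp]: "poly_eval (\<Sum>x\<in>A. f x) v = (\<Sum>x\<in>A. poly_eval (f x) v)"
  by (induction A rule: infinite_finite_induct) auto

lemma sum_of_terms:
  "F = (\<Sum>m\<in>Poly_Mapping.keys F. Poly_Mapping.single m (Poly_Mapping.lookup F m))"
  by (rule poly_mapping_eqI)
     (auto simp: lookup_sum lookup_single when_def in_keys_iff sum.delta)

lemma poly_eval_mult [simp]: "poly_eval (F * G) v = poly_eval F v * poly_eval G v"
proof -
  have "poly_eval (F * G) v = poly_eval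
      ((\<Sum>m\<in>Poly_Mapping.keys F. Poly_Mapping.single m (Poly_Mapping.lookup F m)) *
       (\<Sum>n\<in>Poly_Mapping.keys G. Poly_Mapping.single n (Poly_Mapping.lookup G n))) v"
    by (simp flip: sum_of_terms)
  also have "\<dots> = poly_eval F v * poly_eval G v"
    by (simp add: sum_product mult_single mono_eval_add poly_eval_altdef[of F] poly_eval_altdef[of G]
        algebra_simps)
  finally show ?thesis .
qed

lemma poly_eval_power [simp]: "poly_eval (F ^ n) v = poly_eval F v ^ n"
  by (induction n) auto

lemma poly_eval_prod [simp]: "poly_eval (\<Prod>x\<in>A. f x) v = (\<Prod>x\<in>A. poly_eval (f x) v)"
  by (induction A rule: infinite_finite_induct) auto

lemma poly_eval_diff [simp]: "poly_eval (F - G) v = poly_eval F v - poly_eval G v"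
  using poly_eval_add[of "F - G" G v] by (simp add: algebra_simps)

lemma poly_eval_subst: "poly_eval (poly_subst F g) v = poly_eval F (\<chi> j. poly_eval (g j) v)"
  by (simp add: poly_subst_def poly_eval_def[of F])

lemma poly_eval_at_0: "poly_eval F 0 = Poly_Mapping.lookup F 0"
proof -
  have mono: "mono_eval 0 m = (if m = 0 then 1 else 0)" for m
    by (auto simp: mono_eval_def poly_mapping_eq_iff fun_eq_iff)
  show ?thesis
    by (simp add: poly_eval_altdef mono in_keys_iff if_distrib cong: if_cong)
qed

lemma prod_UNIV_3: "prod f (UNIV :: 3 set) = f 1 * f 2 * f 3"
  unfolding UNIV_3 by (simp add: ac_simps)

text \<open>Kronecker substitution: along the curve \<open>t \<mapsto> (t, t ^ N, t ^ (N * N))\<close> with \<open>N\<close> larger than every exponent of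
  \<open>F\<close>, the monomials of \<open>F\<close> become distinct powers of \<open>t\<close>. Nothing cancels, and the claim reduces to
  univariate polynomials over an infinite field.\<close>

lemma poly_eval_nonzero:
  assumes "F \<noteq> 0"
  obtains v where "poly_eval F v \<noteq> 0"
proof (rule ccontr)
  assume "\<not> thesis"
  then have zero: "poly_eval F v = 0" for v using that by blast
  define N where "N = Suc (\<Sum>m\<in>Poly_Mapping.keys F. mon_deg m)"
  define \<kappa> where "\<kappa> m = Poly_Mapping.lookup m 1 + N * (Poly_Mapping.lookup m 2 + N * Poly_Mapping.lookup m 3)"
    for m :: "3 \<Rightarrow>\<^sub>0 nat"
  have bound: "Poly_Mapping.lookup m i < N" if "m \<in> Poly_Mapping.keys F" for m i
  proof -
    have "Poly_Mapping.lookup m i \<le> mon_deg m"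
      unfolding mon_deg_def by (rule member_le_sum) auto
    also have "\<dots> \<le> (\<Sum>m\<in>Poly_Mapping.keys F. mon_deg m)"
      using that by (intro member_le_sum) auto
    finally show ?thesis by (simp add: N_def)
  qed
  have inj: "m = n" if mn: "m \<in> Poly_Mapping.keys F" "n \<in> Poly_Mapping.keys F" and eq: "\<kappa> m = \<kappa> n" for m n
  proof -
    \<comment> \<open>Uniqueness of base-\<open>N\<close> expansions.\<close>
    have digits: "a = a' \<and> b = b'" if "a + N * b = a' + N * b'" "a < N" "a' < N" for a b a' b'
    proof -
      have low: "(x + N * y) mod N = x" and high: "(x + N * y) div N = y" if "x < N" for x y
        using that by simp_all
      show ?thesis
        using low[OF that(2), of b] low[OF that(3), of b'] high[OF that(2), of b] high[OF that(3), of b']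
        unfolding that(1) by (intro conjI) (rule trans[OF sym], assumption+)+
    qed
    from digits[OF eq[unfolded \<kappa>_def] bound[OF mn(1)] bound[OF mn(2)]]
    have 1: "Poly_Mapping.lookup m 1 = Poly_Mapping.lookup n 1"
      and 23: "Poly_Mapping.lookup m 2 + N * Poly_Mapping.lookup m 3 =
        Poly_Mapping.lookup n 2 + N * Poly_Mapping.lookup n 3" by blast+
    from 1 digits[OF 23 bound[OF mn(1)] bound[OF mn(2)]] show ?thesis
      by (intro poly_mapping_eqI) (metis exhaust_3)
  qed
  define K where "K = (\<Sum>m\<in>Poly_Mapping.keys F. monom (Poly_Mapping.lookup F m) (\<kappa> m))"
  have "poly (monom c (\<kappa> m)) t = c * mono_eval (vector [t, t ^ N, t ^ (N * N)]) m" for c m t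
    unfolding mono_eval_def prod_UNIV_3 vector_3 \<kappa>_def
    by (simp add: poly_monom power_add power_mult)
  then have "poly K t = poly_eval F (vector [t, t ^ N, t ^ (N * N)])" for t
    unfolding K_def poly_eval_altdef poly_sum by simp
  then have "K = 0"
    using zero poly_all_0_iff_0 by metis
  have "Poly_Mapping.lookup F m = 0" if m: "m \<in> Poly_Mapping.keys F" for m
  proof -
    have "coeff K (\<kappa> m) = (\<Sum>n\<in>Poly_Mapping.keys F. if n = m then Poly_Mapping.lookup F n else 0)"
      unfolding K_def coeff_sum by (intro sum.cong refl) (use inj m in auto)
    with m \<open>K = 0\<close> show ?thesis by simp
  qed
  then have "F = 0"
    by (intro poly_mapping_eqI) (auto simp: in_keys_iff)
  with assms show False by simp
qed

lemma poly_eval_ext: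
  assumes "\<And>v. poly_eval F v = poly_eval G v"
  shows "F = G"
  using poly_eval_nonzero[of "F - G"] assms by force

lemma mon_deg_le_deg: "m \<in> Poly_Mapping.keys F \<Longrightarrow> mon_deg m \<le> deg F"
  unfolding deg_def by (rule Max_ge) auto

lemma homogeneous_mon_deg:
  assumes "homogeneous F" "m \<in> Poly_Mapping.keys F"
  shows "mon_deg m = deg F"
proof -
  from assms obtain n where n: "\<forall>m\<in>Poly_Mapping.keys F. mon_deg m = n"
    by (auto simp: homogeneous_def)
  with assms have "mon_deg ` Poly_Mapping.keys F = {n}" by force
  with n assms show ?thesis by (simp add: deg_def)
qed

lemma poly_eval_homogeneous:
  assumes "homogeneous F"
  shows "poly_eval F (c *s v) = c ^ deg F * poly_eval F v"
  unfolding poly_eval_altdef sum_distrib_left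
  by (intro sum.cong refl) (simp add: mono_eval_smult homogeneous_mon_deg[OF assms])

lemma unit_poly_eval_nonzero: "G dvd 1 \<Longrightarrow> poly_eval G v \<noteq> 0"
  using poly_eval_mult[of G _ v] by (metis dvdE mult_zero_left poly_eval_1 zero_neq_one)

section \<open>Linear forms\<close>

definition linear_form :: "complex ^ 3 \<Rightarrow> cpoly3" where
  "linear_form a = (\<Sum>i\<in>UNIV. const (a $ i) * Var i)"

lemma poly_eval_linear_form [simp]: "poly_eval (linear_form a) v = (\<Sum>i\<in>UNIV. a $ i * v $ i)"
  by (simp add: linear_form_def)

lemma linear_form_nonzero:
  assumes "a \<noteq> 0"
  obtains v where "poly_eval (linear_form a) v \<noteq> 0"
proof -
  from assms obtain i where i: "a $ i \<noteq> 0" by (auto simp: vec_eq_iff)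
  have "poly_eval (linear_form a) (axis i 1) = a $ i"
    by (simp add: axis_def if_distrib cong: if_cong)
  with i that show thesis by metis
qed

lemma mon_deg_keys_linear_form:
  assumes "m \<in> Poly_Mapping.keys (linear_form a)"
  shows "mon_deg m = 1"
proof -
  have "linear_form a = (\<Sum>i\<in>UNIV. Poly_Mapping.single (Poly_Mapping.single i 1) (a $ i))"
    by (simp add: linear_form_def const_def Var_def mult_single)
  with assms have "m \<in> (\<Union>i. Poly_Mapping.keys
      (Poly_Mapping.single (Poly_Mapping.single i (1 :: nat)) (a $ i)))"
    using keys_sum[of "\<lambda>i. Poly_Mapping.single (Poly_Mapping.single i (1 :: nat)) (a $ i)" UNIV] by auto
  then obtain i where "m = Poly_Mapping.single i 1"
    by (auto split: if_splits)
  then show ?thesis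
    by (simp add: mon_deg_def lookup_single when_def)
qed

lemma homogeneous_linear_form: "homogeneous (linear_form a)"
  using mon_deg_keys_linear_form unfolding homogeneous_def by blast

lemma deg_linear_form:
  assumes "a \<noteq> 0"
  shows "deg (linear_form a) = 1"
proof -
  from linear_form_nonzero[OF assms] have "linear_form a \<noteq> 0" by force
  then obtain m where "m \<in> Poly_Mapping.keys (linear_form a)"
    by (metis ex_in_conv keys_eq_empty)
  then show ?thesis
    using homogeneous_mon_deg[OF homogeneous_linear_form] mon_deg_keys_linear_form by metis
qed

section \<open>Restriction to a parametrized line\<close>

definition restrict_to_line :: "cpoly3 \<Rightarrow> complex ^ 3 \<Rightarrow> complex ^ 3 \<Rightarrow> complex poly" where
  "restrict_to_line F w z = (\<Sum>m\<in>Poly_Mapping.keys F.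
     smult (Poly_Mapping.lookup F m) (\<Prod>i\<in>UNIV. [:w $ i, z $ i:] ^ Poly_Mapping.lookup m i))"

lemma poly_restrict_to_line [simp]:
  "poly (restrict_to_line F w z) s = poly_eval F (w + s *s z)"
  by (simp add: restrict_to_line_def poly_eval_def poly_sum poly_prod)

lemma degree_restrict_to_line: "degree (restrict_to_line F w z) \<le> deg F"
  unfolding restrict_to_line_def
proof (intro degree_sum_le)
  fix m assume m: "m \<in> Poly_Mapping.keys F"
  have "degree (\<Prod>i\<in>UNIV. [:w $ i, z $ i:] ^ Poly_Mapping.lookup m i)
      \<le> (\<Sum>i\<in>UNIV. degree ([:w $ i, z $ i:] ^ Poly_Mapping.lookup m i))"
    using degree_prod_sum_le[of UNIV "\<lambda>i. [:w $ i, z $ i:] ^ Poly_Mapping.lookup m i"]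
    by (simp add: o_def)
  also have "\<dots> \<le> (\<Sum>i\<in>UNIV. Poly_Mapping.lookup m i)"
  proof (rule sum_mono)
    fix i :: 3
    have "degree ([:w $ i, z $ i:] ^ Poly_Mapping.lookup m i) 
        \<le> degree [:w $ i, z $ i:] * Poly_Mapping.lookup m i"
      by (rule degree_power_le)
    also have "\<dots> \<le> 1 * Poly_Mapping.lookup m i"
      by (intro mult_right_mono) auto
    finally show "degree ([:w $ i, z $ i:] ^ Poly_Mapping.lookup m i) \<le> Poly_Mapping.lookup m i"
      by simp
  qed
  also have "\<dots> \<le> deg F"
    using mon_deg_le_deg[OF m] by (simp add: mon_deg_def)
  finally show "degree (smult (Poly_Mapping.lookup F m)
      (\<Prod>i\<in>UNIV. [:w $ i, z $ i:] ^ Poly_Mapping.lookup m i)) \<le> deg F"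
    using degree_smult_le order_trans by blast
qed auto

lemma restrict_to_line_nonzero: 
  "poly_eval F (w + s *s z) \<noteq> 0 \<Longrightarrow> restrict_to_line F w z \<noteq> 0"
  using poly_restrict_to_line[of F w z s] by force

text \<open>Two nonconstant factors \<open>A\<close>, \<open>B\<close> would both differ
  from their values at the origin at a common point \<open>x\<close>, because the product of the two nonzero
  polynomials \<open>A - A(0)\<close> and \<open>B - B(0)\<close> is nonzero. Along the line \<open>s \<mapsto> s x\<close> both are then
  nonconstant, so that their product has degree at least 2, whereas a linear form has degree at
  most 1 there.\<close>

lemma irreducible_linear_form:
  assumes "a \<noteq> 0"
  shows "irreducible (linear_form a)"
proof (rule irreducibleI)
  show "linear_form a \<noteq> 0"
    using linear_form_nonzero[OF assms] by force
  show "\<not> linear_form a dvd 1"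
    using unit_poly_eval_nonzero[of "linear_form a" 0] by auto
  fix A B assume AB: "linear_form a = A * B"
  have unit: "C dvd 1" if "C dvd linear_form a" "C = const (poly_eval C 0)" for C
  proof -
    have "poly_eval C 0 \<noteq> 0"
    proof
      assume "poly_eval C 0 = 0"
      with that(2) have "C = 0" by (simp add: const_def)
      with that(1) \<open>linear_form a \<noteq> 0\<close> show False by simp
    qed
    then have "C * const (1 / poly_eval C 0) = 1"
      by (intro poly_eval_ext) (subst that(2), simp)
    then show ?thesis by (metis dvdI)
  qed
  show "A dvd 1 \<or> B dvd 1"
  proof (rule ccontr)
    assume "\<not> (A dvd 1 \<or> B dvd 1)"
    with unit AB have "A - const (poly_eval A 0) \<noteq> 0" "B - const (poly_eval B 0) \<noteq> 0"
      by (metis dvd_triv_left eq_iff_diff_eq_0, metis dvd_triv_right eq_iff_diff_eq_0)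
    then have "(A - const (poly_eval A 0)) * (B - const (poly_eval B 0)) \<noteq> 0" by simp
    then obtain x where x: "poly_eval A x \<noteq> poly_eval A 0" "poly_eval B x \<noteq> poly_eval B 0"
      by (rule poly_eval_nonzero) auto
    have pos: "0 < degree (restrict_to_line C 0 x)" if "poly_eval C x \<noteq> poly_eval C 0" for C
    proof (rule ccontr)
      assume "\<not> 0 < degree (restrict_to_line C 0 x)"
      then obtain c where "restrict_to_line C 0 x = [:c:]" by (auto elim: degree_eq_zeroE)
      then have "poly (restrict_to_line C 0 x) s = c" for s by simp
      from this[of 0] this[of 1] that show False by simp
    qed
    have "restrict_to_line (linear_form a) 0 x = restrict_to_line A 0 x * restrict_to_line B 0 x"
      by (intro poly_ext) (simp add: AB del: poly_eval_linear_form)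
    moreover have "degree (restrict_to_line A 0 x * restrict_to_line B 0 x) =
        degree (restrict_to_line A 0 x) + degree (restrict_to_line B 0 x)"
      using pos[OF x(1)] pos[OF x(2)] by (intro degree_mult_eq) auto
    ultimately show False
      using pos[OF x(1)] pos[OF x(2)] degree_restrict_to_line[of "linear_form a" 0 x]
        deg_linear_form[OF assms] by simp
  qed
qed

section \<open>Forms vanishing on a line\<close>

lemma dvd_power_diff: "(L::'a::comm_ring_1) dvd x - y \<Longrightarrow> L dvd x ^ n - y ^ n"
proof (induction n)
  case (Suc n)
  have "x ^ Suc n - y ^ Suc n = x * (x ^ n - y ^ n) + (x - y) * y ^ n"
    by (simp add: algebra_simps)
  with Suc show ?case by simp
qed simp

lemma dvd_prod_diff:
  assumes "\<And>i. i \<in> A \<Longrightarrow> (L::'a::comm_ring_1) dvd f i - g i"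
  shows "L dvd prod f A - prod g A"
  using assms
proof (induction A rule: infinite_finite_induct)
  case (insert i A)
  have "prod f (insert i A) - prod g (insert i A) =
      f i * (prod f A - prod g A) + (f i - g i) * prod g A"
    using insert.hyps by (simp add: algebra_simps)
  with insert show ?case by simp
qed auto

lemma dvd_poly_subst_diff:
  assumes "\<And>j. L dvd g j - h j"
  shows "L dvd poly_subst F g - poly_subst F h"
  unfolding poly_subst_def sum_subtractf[symmetric] right_diff_distrib[symmetric]
  by (intro dvd_sum dvd_mult dvd_prod_diff dvd_power_diff assms)

lemma poly_subst_Var: "poly_subst F Var = F"
  by (rule poly_eval_ext) (simp add: poly_eval_subst)

text \<open>Where \<open>a\<^sub>i \<noteq> 0\<close>, the substitution \<open>x\<^sub>i \<mapsto> x\<^sub>i - (a \<bullet> x) / a\<^sub>i\<close> is a projection onto the plane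
  \<open>a \<bullet> x = 0\<close>, so it sends \<open>F\<close> to zero. It changes every variable by a multiple of the linear form,
  so it does not change \<open>F\<close> modulo the linear form.\<close>

lemma linear_form_dvd:
  assumes "a \<noteq> 0"
    and van: "\<And>v. (\<Sum>i\<in>UNIV. a $ i * v $ i) = 0 \<Longrightarrow> poly_eval F v = 0"
  shows "linear_form a dvd F"
proof -
  from assms obtain i where i: "a $ i \<noteq> 0" by (auto simp: vec_eq_iff)
  define \<sigma> where "\<sigma> j = Var j - (if j = i then const (1 / a $ i) * linear_form a else 0)" for j
  have "poly_eval (poly_subst F \<sigma>) v = 0" for v
  proof -
    define t where "t = (\<Sum>j\<in>UNIV. a $ j * v $ j)"
    have "poly_eval (poly_subst F \<sigma>) v = poly_eval F (\<chi> j. v $ j - (if j = i then t / a $ i else 0))"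
      unfolding poly_eval_subst t_def
      by (rule arg_cong[where f = "poly_eval F"]) (auto simp: vec_eq_iff \<sigma>_def)
    also have "\<dots> = 0"
    proof (rule van)
      have "(\<Sum>j\<in>UNIV. a $ j * (if j = i then t / a $ i else 0)) = t"
        using i by (simp add: if_distrib cong: if_cong)
      then show "(\<Sum>j\<in>UNIV. a $ j * (\<chi> j. v $ j - (if j = i then t / a $ i else 0)) $ j) = 0"
        unfolding vec_lambda_beta right_diff_distrib sum_subtractf by (simp add: t_def)
    qed
    finally show ?thesis .
  qed
  then have "poly_subst F \<sigma> = 0"
    by (intro poly_eval_ext) simp
  moreover have "linear_form a dvd poly_subst F Var - poly_subst F \<sigma>"
    by (rule dvd_poly_subst_diff) (simp add: \<sigma>_def)
  ultimately show ?thesis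
    by (simp add: poly_subst_Var)
qed

text \<open>Up to a unit, an irreducible polynomial that vanishes on a line is the equation of this line, so
  its zeros are all on the line.\<close>

lemma irreducible_vanishing_on_line:
  assumes "irreducible F" "a \<noteq> 0"
    and "\<And>v. (\<Sum>i\<in>UNIV. a $ i * v $ i) = 0 \<Longrightarrow> poly_eval F v = 0"
    and "(\<Sum>i\<in>UNIV. a $ i * v $ i) \<noteq> 0"
  shows "poly_eval F v \<noteq> 0"
proof -
  have "linear_form a dvd F"
    by (rule linear_form_dvd) (use assms in auto)
  then obtain G where G: "F = linear_form a * G" by (elim dvdE)
  have "\<not> linear_form a dvd 1"
    using unit_poly_eval_nonzero[of "linear_form a" 0] by auto
  with G assms(1) have "G dvd 1"
    using irreducibleD by blast
  with G assms(4) show ?thesis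
    using unit_poly_eval_nonzero by simp
qed

section \<open>Multiplicities\<close>

lemma poly_eval_local_equation:
  assumes "v $ i = 1"
  shows "poly_eval (local_equation F v i) x = poly_eval F (v + (\<chi> j. if j = i then 0 else x $ j))"
  unfolding local_equation_def poly_eval_subst
  by (rule arg_cong[where f = "poly_eval F"]) (use assms in \<open>auto simp: vec_eq_iff\<close>)

text \<open>The form \<open>F\<close> has a nonzero value inside the chart: the polynomial \<open>F x\<^sub>i\<close> is nonzero, so some
  \<open>y\<close> satisfies both \<open>F(y) \<noteq> 0\<close> and \<open>y\<^sub>i \<noteq> 0\<close>, and \<open>y\<close> can be rescaled to \<open>y\<^sub>i = 1\<close>.\<close>

lemma local_equation_nonzero:
  assumes "homogeneous F" "F \<noteq> 0" "v $ i = 1"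
  shows "local_equation F v i \<noteq> 0"
proof -
  have "Var i \<noteq> 0"
    using poly_eval_Var[of i "axis i 1"] by force
  with assms have "F * Var i \<noteq> 0" by simp
  then obtain y where y: "poly_eval F y \<noteq> 0" "y $ i \<noteq> 0"
    by (rule poly_eval_nonzero) auto
  have eq: "y = y $ i *s (v + (\<chi> j. if j = i then 0 else (inverse (y $ i) *s y - v) $ j))"
    using y assms by (auto simp: vec_eq_iff field_simps)
  have "poly_eval F y = y $ i ^ deg F * poly_eval (local_equation F v i) (inverse (y $ i) *s y - v)"
    unfolding poly_eval_local_equation[OF assms(3)] poly_eval_homogeneous[OF assms(1), symmetric]
    by (rule arg_cong[OF eq])
  with y(1) have "poly_eval (local_equation F v i) (inverse (y $ i) *s y - v) \<noteq> 0" by auto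
  then show ?thesis by force
qed

text \<open>The multiplicity is computed in some chart. This is all that the estimates below use, since
  each of them is proved for an arbitrary chart that contains the point.\<close>

lemma curve_mult_cases:
  obtains v i where "v $ i = 1" "p = point v" "curve_mult p F = ord0 (local_equation F v i)"
proof -
  from ex_point obtain u where u: "u \<noteq> 0" "p = point u" by blast
  then obtain i where i: "u $ i \<noteq> 0" by (auto simp: vec_eq_iff)
  define v where "v = inverse (u $ i) *s u"
  have v: "v $ i = 1" using i by (simp add: v_def)
  have "v \<noteq> 0" using v by force
  have "p = point v"
    unfolding u(2) using u(1) \<open>v \<noteq> 0\<close> i
    by (subst point_eq_iff) (auto simp: v_def intro!: exI[of _ "inverse (u $ i)"])
  with v have "\<exists>m v i. v $ i = 1 \<and> p = point v \<and> m = ord0 (local_equation F v i)" by blast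
  then have "\<exists>v i. v $ i = 1 \<and> p = point v \<and> curve_mult p F = ord0 (local_equation F v i)"
    unfolding curve_mult_def by (rule someI_ex)
  with that show thesis by blast
qed

lemma point_eqD:
  assumes "point u = point v" "u \<noteq> 0" "v \<noteq> 0"
  obtains c where "c \<noteq> 0" "u = c *s v"
  using assms point_eq_iff[of v u] by metis

lemma curve_mult_eq_0_iff:
  assumes "homogeneous F" "F \<noteq> 0" "u \<noteq> 0"
  shows "curve_mult (point u) F = 0 \<longleftrightarrow> poly_eval F u \<noteq> 0"
proof -
  obtain v i where v: "v $ i = 1" "point u = point v"
      "curve_mult (point u) F = ord0 (local_equation F v i)"
    by (rule curve_mult_cases)
  have "v \<noteq> 0" using v(1) by force
  with v assms obtain c where c: "c \<noteq> 0" "u = c *s v" by (metis point_eqD)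
  let ?f = "local_equation F v i"
  have fin: "finite (mon_deg ` Poly_Mapping.keys ?f)" "mon_deg ` Poly_Mapping.keys ?f \<noteq> {}"
    using local_equation_nonzero[OF assms(1,2) v(1)] by auto
  have mon_deg_0: "mon_deg m = 0 \<longleftrightarrow> m = 0" for m
    unfolding mon_deg_def by (auto intro: poly_mapping_eqI)
  have "ord0 ?f = 0 \<longleftrightarrow> 0 \<in> Poly_Mapping.keys ?f"
    unfolding ord0_def
  proof
    assume "Min (mon_deg ` Poly_Mapping.keys ?f) = 0"
    with Min_in[OF fin] obtain m where "m \<in> Poly_Mapping.keys ?f" "mon_deg m = 0"
      by (metis imageE)
    with mon_deg_0[of m] show "0 \<in> Poly_Mapping.keys ?f" by simp
  next
    assume "0 \<in> Poly_Mapping.keys ?f"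
    then have "mon_deg 0 \<in> mon_deg ` Poly_Mapping.keys ?f" by (rule imageI)
    with Min_le[OF fin(1)] mon_deg_0[of 0] show "Min (mon_deg ` Poly_Mapping.keys ?f) = 0"
      by (metis le_zero_eq)
  qed
  also have "\<dots> \<longleftrightarrow> poly_eval ?f 0 \<noteq> 0"
    by (simp add: poly_eval_at_0 in_keys_iff)
  also have "poly_eval ?f 0 = poly_eval F v"
    unfolding poly_eval_local_equation[OF v(1)]
    by (rule arg_cong[where f = "poly_eval F"]) (auto simp: vec_eq_iff)
  also have "poly_eval F v \<noteq> 0 \<longleftrightarrow> poly_eval F u \<noteq> 0"
    using c by (simp add: poly_eval_homogeneous assms)
  finally show ?thesis using v by simp
qed

text \<open>The multiplicity at a point bounds the intersection multiplicity with a line through it. Take a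
  chart \<open>x\<^sub>i = 1\<close> around the point, with representative \<open>v\<close> and local equation \<open>f\<close>. A general point
  of the line is \<open>\<rho> v + \<tau> y\<close> with \<open>y\<^sub>i = 0\<close>, where \<open>\<tau> = t - s\<close> and where \<open>\<rho>\<close> is a polynomial of degree
  at most 1 in \<open>t\<close> with \<open>\<rho>(s) \<noteq> 0\<close>. By homogeneity, \<open>F(\<rho> v + \<tau> y) = \<rho>\<^sup>e f((\<tau> / \<rho>) y)\<close> with
  \<open>e = deg F\<close>. Clearing denominators with a power of \<open>\<rho>\<close>, which does not vanish at \<open>s\<close>, exhibits the
  factor \<open>\<tau>\<close> to the order of \<open>f\<close>.\<close>

lemma curve_mult_le_order:
  assumes F: "homogeneous F" and R: "restrict_to_line F w z \<noteq> 0" and u: "w + s *s z \<noteq> 0"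
  shows "curve_mult (point (w + s *s z)) F \<le> order s (restrict_to_line F w z)"
proof -
  define R where "R = restrict_to_line F w z"
  obtain v i where v: "v $ i = 1" "point (w + s *s z) = point v"
      "curve_mult (point (w + s *s z)) F = ord0 (local_equation F v i)"
    by (rule curve_mult_cases)
  have "v \<noteq> 0" using v(1) by force
  with v u obtain c where c: "c \<noteq> 0" "w + s *s z = c *s v" by (metis point_eqD)
  define f where "f = local_equation F v i"
  define y where "y = z - (z $ i) *s v"
  have "y $ i = 0" using v by (simp add: y_def)
  define \<rho> where "\<rho> = [:c - s * z $ i, z $ i:]"
  define \<tau> where "\<tau> = [:-s, 1:]"
  have point: "w + t *s z = poly \<rho> t *s v + poly \<tau> t *s y" for t
  proof -
    have "w + t *s z = (w + s *s z) + (t - s) *s z"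
      by (simp add: vec_eq_iff algebra_simps)
    also have "\<dots> = poly \<rho> t *s v + poly \<tau> t *s y"
      unfolding c \<rho>_def \<tau>_def y_def by (simp add: vec_eq_iff algebra_simps)
    finally show ?thesis .
  qed
  define Q where "Q = (\<Sum>m\<in>Poly_Mapping.keys f. smult (Poly_Mapping.lookup f m * mono_eval y m)
    (\<tau> ^ mon_deg m * \<rho> ^ (deg f - mon_deg m)))"
  have "\<rho> \<noteq> 0" using c(1) by (auto simp: \<rho>_def)
  have "poly (\<rho> ^ deg f * R) t = poly (\<rho> ^ deg F * Q) t" if "poly \<rho> t \<noteq> 0" for t
  proof -
    have "poly R t = poly_eval F (poly \<rho> t *s (v + (poly \<tau> t / poly \<rho> t) *s y))"
      unfolding R_def using that
      by (simp add: point vector_add_ldistrib vector_smult_assoc)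
    also have "\<dots> = poly \<rho> t ^ deg F * poly_eval F (v + (poly \<tau> t / poly \<rho> t) *s y)"
      by (rule poly_eval_homogeneous[OF F])
    also have "poly_eval F (v + (poly \<tau> t / poly \<rho> t) *s y) = poly_eval f ((poly \<tau> t / poly \<rho> t) *s y)"
      unfolding f_def poly_eval_local_equation[OF v(1)]
      by (rule arg_cong[where f = "poly_eval F"]) (use \<open>y $ i = 0\<close> in \<open>auto simp: vec_eq_iff\<close>)
    finally have "poly R t = poly \<rho> t ^ deg F * poly_eval f ((poly \<tau> t / poly \<rho> t) *s y)" .
    moreover have "poly \<rho> t ^ deg f * poly_eval f ((poly \<tau> t / poly \<rho> t) *s y) = poly Q t"
      unfolding poly_eval_altdef Q_def poly_sum sum_distrib_left
    proof (intro sum.cong refl)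
      fix m assume "m \<in> Poly_Mapping.keys f"
      then have "poly \<rho> t ^ deg f = poly \<rho> t ^ mon_deg m * poly \<rho> t ^ (deg f - mon_deg m)"
        using mon_deg_le_deg by (simp flip: power_add)
      with that show "poly \<rho> t ^ deg f * (Poly_Mapping.lookup f m *
            mono_eval ((poly \<tau> t / poly \<rho> t) *s y) m) =
          poly (smult (Poly_Mapping.lookup f m * mono_eval y m)
            (\<tau> ^ mon_deg m * \<rho> ^ (deg f - mon_deg m))) t"
        by (simp add: mono_eval_smult power_divide field_simps)
    qed
    ultimately show ?thesis
      by (simp add: algebra_simps)
  qed
  \<comment> \<open>The additional factor \<open>\<rho>\<close> covers the zero of \<open>\<rho>\<close>, where the previous identity is not available.\<close>
  then have "poly (\<rho> * (\<rho> ^ deg f * R)) t = poly (\<rho> * (\<rho> ^ deg F * Q)) t" for t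
    by (cases "poly \<rho> t = 0") auto
  then have "\<rho> * (\<rho> ^ deg f * R) = \<rho> * (\<rho> ^ deg F * Q)"
    by (intro poly_ext) auto
  with \<open>\<rho> \<noteq> 0\<close> have eq: "\<rho> ^ deg f * R = \<rho> ^ deg F * Q" by simp
  have "\<tau> ^ ord0 f dvd \<tau> ^ mon_deg m" if "m \<in> Poly_Mapping.keys f" for m
    using that by (intro le_imp_power_dvd) (auto simp: ord0_def)
  then have "\<tau> ^ ord0 f dvd Q"
    unfolding Q_def by (intro dvd_sum dvd_smult dvd_mult2)
  then have "\<tau> ^ ord0 f dvd \<rho> ^ deg f * R"
    unfolding eq by simp
  moreover have "\<rho> ^ deg f * R \<noteq> 0"
    using \<open>\<rho> \<noteq> 0\<close> R by (simp add: R_def)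
  ultimately have "ord0 f \<le> order s (\<rho> ^ deg f * R)"
    unfolding \<tau>_def order_divides by blast
  also have "\<dots> = order s (\<rho> ^ deg f) + order s R"
    by (rule order_mult) fact
  also have "order s (\<rho> ^ deg f) = 0"
    using c(1) by (intro order_0I) (simp add: \<rho>_def)
  finally show ?thesis
    using v by (simp add: R_def f_def)
qed

text \<open>Bezout's inequality for a line that is not a component of the curve: the restriction of \<open>F\<close> to
  the line is a nonzero univariate polynomial, whose roots, with multiplicity, number at most its degree.\<close>

lemma sum_curve_mult_le_deg:
  assumes F: "homogeneous F" and X: "poly_eval F (w + s0 *s z) \<noteq> 0"
    and "finite S" and S: "\<And>s. s \<in> S \<Longrightarrow> w + s *s z \<noteq> 0"
  shows "(\<Sum>s\<in>S. curve_mult (point (w + s *s z)) F) \<le> deg F"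
proof -
  define R where "R = restrict_to_line F w z"
  have R: "R \<noteq> 0"
    using X by (simp add: R_def restrict_to_line_nonzero)
  have "(\<Sum>s\<in>S. curve_mult (point (w + s *s z)) F) \<le> (\<Sum>s\<in>S. order s R)"
    using R unfolding R_def by (intro sum_mono curve_mult_le_order F S)
  also have "\<dots> = (\<Sum>s\<in>{s\<in>S. poly R s = 0}. order s R)"
    using \<open>finite S\<close> R by (intro sum.mono_neutral_right) (auto simp: order_root)
  also have "\<dots> \<le> (\<Sum>s | poly R s = 0. order s R)"
    using R by (intro sum_mono2 poly_roots_finite) auto
  also have "\<dots> \<le> degree R"
    by (rule sum_order_le_degree) fact
  also have "\<dots> \<le> deg F"
    unfolding R_def by (rule degree_restrict_to_line)
  finally show ?thesis .
qed

text \<open>Bezout's inequality for the line that joins \<open>p\<close> to a point off the curve.\<close>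

lemma curve_mult_le_deg:
  assumes "homogeneous F" "F \<noteq> 0"
  shows "curve_mult p F \<le> deg F"
proof -
  obtain v where v: "v \<noteq> 0" "p = point v" using ex_point by blast
  obtain X where X: "poly_eval F X \<noteq> 0" using assms(2) by (rule poly_eval_nonzero)
  have "(\<Sum>s\<in>{1}. curve_mult (point (X + s *s (v - X))) F) \<le> deg F"
    using X v by (intro sum_curve_mult_le_deg[of F X 0 "v - X"] assms) auto
  with v show ?thesis by simp
qed

section \<open>Lines\<close>

definition cross :: "complex ^ 3 \<Rightarrow> complex ^ 3 \<Rightarrow> complex ^ 3" where
  "cross a b = vector [a $ 2 * b $ 3 - a $ 3 * b $ 2, a $ 3 * b $ 1 - a $ 1 * b $ 3,
     a $ 1 * b $ 2 - a $ 2 * b $ 1]"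

lemma cross_eq_0_imp_parallel:
  assumes "cross a b = 0" "a \<noteq> 0"
  obtains c where "b = c *s a"
proof -
  from assms(1) have eqs: "a $ 2 * b $ 3 = a $ 3 * b $ 2" "a $ 3 * b $ 1 = a $ 1 * b $ 3"
      "a $ 1 * b $ 2 = a $ 2 * b $ 1"
    by (simp_all add: cross_def vec_eq_iff forall_3)
  then have minors: "a $ i * b $ j = a $ j * b $ i" for i j
    using exhaust_3[of i] exhaust_3[of j] by (elim disjE) simp_all
  from assms(2) obtain i where i: "a $ i \<noteq> 0" by (auto simp: vec_eq_iff)
  have "b = (b $ i / a $ i) *s a"
    using i minors[of i] by (simp add: vec_eq_iff field_simps)
  with that show thesis .
qed

lemma cross_diff_smult: "cross X (u - k *s w) = k *s cross w X - cross u X"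
  by (simp add: cross_def vec_eq_iff forall_3 algebra_simps)

text \<open>From \<open>(u \<times> v) \<times> a = (a \<bullet> u) v - (a \<bullet> v) u\<close>. So two independent
  vectors in the plane \<open>a \<bullet> x = 0\<close> determine \<open>a\<close> up to a scalar, as a multiple of their cross product.\<close>

lemma cross_cross_orthogonal:
  assumes "(\<Sum>i\<in>UNIV. a $ i * u $ i) = 0" "(\<Sum>i\<in>UNIV. a $ i * v $ i) = 0"
  shows "cross (cross u v) a = 0"
proof -
  have "cross (cross u v) a = (\<Sum>i\<in>UNIV. a $ i * u $ i) *s v - (\<Sum>i\<in>UNIV. a $ i * v $ i) *s u"
    by (simp add: cross_def vec_eq_iff forall_3 sum_3 algebra_simps)
  with assms show ?thesis by simp
qed

lemma point_smult: "c \<noteq> 0 \<Longrightarrow> u \<noteq> 0 \<Longrightarrow> point (c *s u) = point u"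
  using point_eq_iff[of u "c *s u"] by (auto simp: vec_eq_iff)

lemma point_in_line_iff:
  assumes "u \<noteq> 0"
  shows "point u \<in> line a \<longleftrightarrow> (\<Sum>i\<in>UNIV. a $ i * u $ i) = 0"
proof
  assume "point u \<in> line a"
  then obtain v where v: "v \<noteq> 0" "point u = point v" "(\<Sum>i\<in>UNIV. a $ i * v $ i) = 0"
    by (auto simp: line_def)
  with assms obtain c where "u = c *s v" by (metis point_eqD)
  with v(3) show "(\<Sum>i\<in>UNIV. a $ i * u $ i) = 0"
    by (simp add: mult.left_commute flip: sum_distrib_left)
qed (use assms in \<open>auto simp: line_def\<close>)

lemma line_smult: "c \<noteq> 0 \<Longrightarrow> line (c *s a) = line a"
  by (simp add: line_def mult.assoc flip: sum_distrib_left)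

lemma distinct_lines_meet_once:
  assumes "a \<noteq> 0" "b \<noteq> 0" "line a \<noteq> line b"
    and "p \<in> line a" "p \<in> line b" "q \<in> line a" "q \<in> line b"
  shows "p = q"
proof -
  have "cross a b \<noteq> 0"
  proof
    assume "cross a b = 0"
    with assms(1) obtain c where "b = c *s a" by (metis cross_eq_0_imp_parallel)
    with assms(2,3) line_smult[of c a] show False by (cases "c = 0") auto
  qed
  have "r = point (cross a b)" if "r \<in> line a" "r \<in> line b" for r
  proof -
    from ex_point obtain u where u: "u \<noteq> 0" "r = point u" by blast
    with that have "(\<Sum>i\<in>UNIV. u $ i * a $ i) = 0" "(\<Sum>i\<in>UNIV. u $ i * b $ i) = 0"
      by (simp_all add: point_in_line_iff mult.commute)
    then have "cross (cross a b) u = 0"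
      by (rule cross_cross_orthogonal)
    with \<open>cross a b \<noteq> 0\<close> obtain c where c: "u = c *s cross a b"
      by (metis cross_eq_0_imp_parallel)
    with u(1) have "c \<noteq> 0" by auto
    with u c \<open>cross a b \<noteq> 0\<close> show ?thesis
      by (simp add: point_smult)
  qed
  with assms show ?thesis by metis
qed

text \<open>Both cross products \<open>w \<times> X\<close> and \<open>u \<times> X\<close> are nonzero multiples of \<open>a\<close>, hence of each other, where
  \<open>u\<close> represents \<open>q\<close>. So \<open>(u - k w) \<times> X = 0\<close> for some \<open>k \<noteq> 0\<close>, and \<open>u - k w\<close> is a multiple of \<open>X\<close>.\<close>

lemma line_parametrization:
  assumes "a \<noteq> 0" "X \<noteq> 0" "w \<noteq> 0" "point w \<noteq> point X"
    and "point X \<in> line a" "point w \<in> line a" "q \<in> line a" "q \<noteq> point X"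
  obtains s where "w + s *s X \<noteq> 0" "q = point (w + s *s X)"
proof -
  from ex_point obtain u where u: "u \<noteq> 0" "q = point u" by blast
  have multiple: "\<exists>c. c \<noteq> 0 \<and> a = c *s cross y X"
    if "y \<noteq> 0" "point y \<in> line a" "point y \<noteq> point X" for y
  proof -
    have "cross y X \<noteq> 0"
    proof
      assume "cross y X = 0"
      with that(1) obtain c where c: "X = c *s y" by (metis cross_eq_0_imp_parallel)
      with \<open>X \<noteq> 0\<close> have "c \<noteq> 0" by auto
      with c that show False by (simp add: point_smult)
    qed
    moreover have "cross (cross y X) a = 0"
      using that assms by (intro cross_cross_orthogonal) (simp_all add: point_in_line_iff)
    ultimately obtain c where "a = c *s cross y X" by (metis cross_eq_0_imp_parallel)
    with \<open>a \<noteq> 0\<close> show ?thesis by (intro exI[of _ c]) auto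
  qed
  from multiple[of w] multiple[of u] assms u obtain c c' where
    c: "c \<noteq> 0" "a = c *s cross w X" and c': "c' \<noteq> 0" "a = c' *s cross u X" by metis
  define k where "k = c / c'"
  have "k \<noteq> 0" using c c' by (simp add: k_def)
  have "c' *s cross u X = c *s cross w X" using c c' by simp
  then have "cross u X = k *s cross w X"
    using c' by (simp add: k_def vec_eq_iff field_simps)
  then have "cross X (u - k *s w) = 0"
    by (simp add: cross_diff_smult)
  with \<open>X \<noteq> 0\<close> obtain \<mu> where "u - k *s w = \<mu> *s X" by (metis cross_eq_0_imp_parallel)
  then have eq: "u = k *s (w + (\<mu> / k) *s X)"
    using \<open>k \<noteq> 0\<close> by (simp add: vec_eq_iff field_simps)
  then have "w + (\<mu> / k) *s X \<noteq> 0"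
    using u(1) by (metis vector_smult_rzero)
  with that[of "\<mu> / k"] u(2) eq \<open>k \<noteq> 0\<close> point_smult show thesis by metis
qed

text \<open>The point \<open>X\<close> off the curve serves as the point at infinity of the parametrization
  \<open>s \<mapsto> w + s X\<close>, which misses it. This loses nothing because the multiplicity at \<open>X\<close> is 0.\<close>

lemma sum_curve_mult_on_line_le_deg:
  assumes F: "homogeneous F" and "a \<noteq> 0" and X: "X \<noteq> 0" "point X \<in> line a" "poly_eval F X \<noteq> 0"
    and "finite Q" "Q \<subseteq> line a"
  shows "(\<Sum>q\<in>Q. curve_mult q F) \<le> deg F"
proof -
  have "F \<noteq> 0" using X(3) by auto
  define Q' where "Q' = Q - {point X}"
  have "(\<Sum>q\<in>Q. curve_mult q F) = (\<Sum>q\<in>Q'. curve_mult q F)"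
    unfolding Q'_def using \<open>finite Q\<close> X curve_mult_eq_0_iff[OF F \<open>F \<noteq> 0\<close>, of X]
    by (intro sum.mono_neutral_right) auto
  also have "\<dots> \<le> deg F"
  proof (cases "Q' = {}")
    case False
    then obtain q0 where "q0 \<in> Q'" by blast
    moreover from ex_point obtain w where w: "w \<noteq> 0" "q0 = point w" by blast
    ultimately have w': "point w \<noteq> point X" "point w \<in> line a"
      using assms by (auto simp: Q'_def)
    have "\<exists>s. w + s *s X \<noteq> 0 \<and> q = point (w + s *s X)" if "q \<in> Q'" for q
      using line_parametrization[of a X w q] assms that w w' unfolding Q'_def by blast
    then obtain \<sigma> where \<sigma>: "\<And>q. q \<in> Q' \<Longrightarrow> w + \<sigma> q *s X \<noteq> 0 \<and> q = point (w + \<sigma> q *s X)"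
      by metis
    have inj: "inj_on \<sigma> Q'" using \<sigma> by (metis inj_onI)
    \<comment> \<open>The curve does not contain the line: near \<open>X\<close>, that is for large \<open>s\<close>, there are points off it.\<close>
    obtain s0 where s0: "poly_eval F (w + s0 *s X) \<noteq> 0"
    proof -
      have "restrict_to_line F X w \<noteq> 0"
        using X by (intro restrict_to_line_nonzero[of F X 0 w]) simp
      then have "finite (insert 0 {t. poly (restrict_to_line F X w) t = 0})"
        using poly_roots_finite by blast
      then obtain t where t: "t \<noteq> 0" "poly (restrict_to_line F X w) t \<noteq> 0"
        using ex_new_if_finite[OF infinite_UNIV_char_0] by blast
      have "X + t *s w = t *s (w + (1 / t) *s X)"
        using t by (simp add: vec_eq_iff field_simps)
      with t poly_eval_homogeneous[OF F, of t "w + (1 / t) *s X"] that show thesis by auto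
    qed
    have "(\<Sum>q\<in>Q'. curve_mult q F) = (\<Sum>q\<in>Q'. curve_mult (point (w + \<sigma> q *s X)) F)"
      using \<sigma> by (intro sum.cong) auto
    also have "\<dots> = (\<Sum>s\<in>\<sigma> ` Q'. curve_mult (point (w + s *s X)) F)"
      by (simp add: sum.reindex[OF inj])
    also have "\<dots> \<le> deg F"
      using \<sigma> \<open>finite Q\<close> by (intro sum_curve_mult_le_deg[OF F s0]) (auto simp: Q'_def)
    finally show ?thesis .
  qed simp
  finally show ?thesis .
qed

section \<open>Hirzebruch's quasipencil\<close>

text \<open>All lines but one pass through the point \<open>p\<close> of multiplicity \<open>d - 1\<close>. Two lines through \<open>p\<close> meet
  only there, so every other singular point lies on the exceptional line.\<close>

lemma quasipencil_transversal:
  assumes "hirzebruch_quasipencil H"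
  obtains a p where "a \<noteq> 0" "p \<in> Sing H" "p \<notin> line a" "Sing H - {p} \<subseteq> line a"
    "card (Sing H - {p}) = card H - 1"
proof -
  from assms have H: "finite H" "\<And>l. l \<in> H \<Longrightarrow> \<exists>a. a \<noteq> 0 \<and> l = line a" "card H \<ge> 3"
    by (auto simp: hirzebruch_quasipencil_def line_arrangement_def)
  from assms obtain p where p: "p \<in> Sing H" "arr_mult H p = card H - 1"
      "card (Sing H - {p}) = card H - 1"
    by (auto simp: hirzebruch_quasipencil_def)
  have "{l \<in> H. p \<notin> l} = H - {l \<in> H. p \<in> l}" by auto
  then have "card {l \<in> H. p \<notin> l} = card H - arr_mult H p"
    using H(1) by (simp add: card_Diff_subset arr_mult_def)
  with p(2) H(3) have "card {l \<in> H. p \<notin> l} = 1" by simp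
  then obtain l where l: "{l \<in> H. p \<notin> l} = {l}" by (auto simp: card_1_singleton_iff)
  then have "l \<in> H" "p \<notin> l" by auto
  with H(2) obtain a where a: "a \<noteq> 0" "l = line a" by blast
  have "q \<in> l" if q: "q \<in> Sing H - {p}" for q
  proof (rule ccontr)
    assume "q \<notin> l"
    from q have "\<not> card {l \<in> H. q \<in> l} \<le> Suc 0"
      by (auto simp: Sing_def arr_mult_def)
    with H(1) obtain l1 l2 where l12: "l1 \<in> H" "l2 \<in> H" "q \<in> l1" "q \<in> l2" "l1 \<noteq> l2"
      by (auto simp: card_le_Suc0_iff_eq)
    with l \<open>q \<notin> l\<close> have "p \<in> l1" "p \<in> l2" by blast+
    from l12 H(2) obtain a1 a2 where "a1 \<noteq> 0" "l1 = line a1" "a2 \<noteq> 0" "l2 = line a2" by metis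
    with distinct_lines_meet_once[of a1 a2 p q] l12 \<open>p \<in> l1\<close> \<open>p \<in> l2\<close> have "p = q" by simp
    with q show False by simp
  qed
  with that p a \<open>p \<notin> l\<close> show thesis by blast
qed

text \<open>If the curve does not contain the line, then Bezout's inequality bounds the sum over \<open>Q\<close> by the
  degree, and the multiplicity at \<open>p\<close> is at most the degree as well; the total is at most twice the
  degree. If it contains the line, then it equals the line and avoids \<open>p\<close>, while each point of \<open>Q\<close>
  contributes at most the degree. The zero \<open>w\<close> ensures \<open>F(0) = 0\<close>, so that in the second case \<open>F\<close> vanishes on the
  whole plane \<open>a \<bullet> v = 0\<close> and not only on its nonzero vectors.\<close>

lemma sum_curve_mult_le_card_times_deg:
  assumes F: "integral_curve F" and "a \<noteq> 0" "p \<notin> line a" "finite Q" "Q \<subseteq> line a" "2 \<le> card Q"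
    and zero: "w \<noteq> 0" "poly_eval F w = 0"
  shows "curve_mult p F + (\<Sum>q\<in>Q. curve_mult q F) \<le> card Q * deg F"
proof -
  from F have hom: "homogeneous F" and irr: "irreducible F" and "F \<noteq> 0"
    by (auto simp: integral_curve_def)
  from ex_point obtain u where u: "u \<noteq> 0" "p = point u" by blast
  note le_deg = curve_mult_le_deg[OF hom \<open>F \<noteq> 0\<close>]
  show ?thesis
  proof (cases "\<exists>X. X \<noteq> 0 \<and> point X \<in> line a \<and> poly_eval F X \<noteq> 0")
    case True
    then have "(\<Sum>q\<in>Q. curve_mult q F) \<le> deg F"
      using sum_curve_mult_on_line_le_deg[OF hom] assms by blast
    with le_deg[of p] have "curve_mult p F + (\<Sum>q\<in>Q. curve_mult q F) \<le> 2 * deg F" by simp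
    also have "\<dots> \<le> card Q * deg F"
      using assms by (intro mult_right_mono) auto
    finally show ?thesis .
  next
    case no_X: False
    have "poly_eval F v = 0" if "(\<Sum>i\<in>UNIV. a $ i * v $ i) = 0" for v
    proof (cases "v = 0")
      case True
      with poly_eval_homogeneous[OF hom, of 0 w] zero show ?thesis by simp
    next
      case False
      with no_X that point_in_line_iff[of v a] show ?thesis by blast
    qed
    then have "poly_eval F u \<noteq> 0"
      using u assms by (intro irreducible_vanishing_on_line[OF irr \<open>a \<noteq> 0\<close>]) (auto simp: point_in_line_iff)
    then have "curve_mult p F = 0"
      using u curve_mult_eq_0_iff[OF hom \<open>F \<noteq> 0\<close>] by simp
    moreover have "(\<Sum>q\<in>Q. curve_mult q F) \<le> card Q * deg F"
      using sum_bounded_above[of Q "\<lambda>q. curve_mult q F" "deg F"] le_deg by simp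
    ultimately show ?thesis by simp
  qed
qed

theorem proposition3p9:
  fixes H :: "proj_plane set set" and d :: nat
  assumes "d \<ge> 3"
    and "hirzebruch_quasipencil H"
    and "card H = d"
  shows "seshadri_P2_O1 (Sing H) = 1 / (real d - 1)"
proof -
  from assms(2) obtain a p where a: "a \<noteq> 0" and p: "p \<in> Sing H" "p \<notin> line a"
    and Q: "Sing H - {p} \<subseteq> line a" "card (Sing H - {p}) = card H - 1"
    by (rule quasipencil_transversal)
  have fin: "finite (Sing H - {p})"
    using Q assms by (intro card_ge_0_finite) simp
  have card: "2 \<le> card (Sing H - {p})" "card (Sing H - {p}) = d - 1"
    using Q assms by auto
  let ?M = "\<lambda>F. \<Sum>q\<in>Sing H. curve_mult q F"
  have M: "?M F = curve_mult p F + (\<Sum>q\<in>Sing H - {p}. curve_mult q F)" for F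
    using fin p by (simp add: sum.remove)
  have bound: "0 < ?M F \<and> ?M F \<le> (d - 1) * deg F"
    if F: "integral_curve F" "zero_locus F \<inter> Sing H \<noteq> {}" for F
  proof
    from F(2) obtain w where w: "w \<noteq> 0" "poly_eval F w = 0" "point w \<in> Sing H"
      by (auto simp: zero_locus_def)
    have "homogeneous F" "F \<noteq> 0"
      using F(1) by (auto simp: integral_curve_def)
    then have "0 < curve_mult (point w) F"
      using curve_mult_eq_0_iff[of F w] w by auto
    also have "\<dots> \<le> ?M F"
      using w fin by (intro member_le_sum) auto
    finally show "0 < ?M F" .
    show "?M F \<le> (d - 1) * deg F"
      unfolding M card(2)[symmetric] using sum_curve_mult_le_card_times_deg F(1) a p Q fin card w by blast
  qed
  let ?L = "linear_form a"
  have L: "integral_curve ?L"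
    using homogeneous_linear_form irreducible_linear_form[OF a] by (simp add: integral_curve_def)
  have L_mult: "1 \<le> curve_mult q ?L" and L_zero: "q \<in> zero_locus ?L" if "q \<in> line a" for q
  proof -
    from ex_point obtain u where u: "u \<noteq> 0" "q = point u" by blast
    with that have "poly_eval ?L u = 0" by (simp add: point_in_line_iff)
    moreover have "?L \<noteq> 0" using L by (auto simp: integral_curve_def)
    ultimately show "1 \<le> curve_mult q ?L" "q \<in> zero_locus ?L"
      using curve_mult_eq_0_iff[OF homogeneous_linear_form, of a u] u
      by (auto simp: zero_locus_def)
  qed
  have L_meets: "zero_locus ?L \<inter> Sing H \<noteq> {}"
  proof -
    from card(1) have "Sing H - {p} \<noteq> {}" by (metis card.empty not_numeral_le_zero)
    then obtain q where "q \<in> Sing H - {p}" by blast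
    with Q L_zero show ?thesis by blast
  qed
  have "d - 1 \<le> (\<Sum>q\<in>Sing H - {p}. curve_mult q ?L)"
    using sum_bounded_below[of "Sing H - {p}" 1 "\<lambda>q. curve_mult q ?L"] L_mult Q card by auto
  with M[of ?L] bound[OF L L_meets] deg_linear_form[OF a] have L_sum: "?M ?L = d - 1" by simp
  show ?thesis
    unfolding seshadri_P2_O1_def
  proof (rule cInf_eq_minimum)
    have "1 / (real d - 1) = real (deg ?L) / real (?M ?L)"
      using assms(1) unfolding L_sum deg_linear_form[OF a] by (simp add: of_nat_diff)
    with L L_meets show "1 / (real d - 1) \<in> {real (deg F) / real (?M F) | F.
        integral_curve F \<and> zero_locus F \<inter> Sing H \<noteq> {}}" by blast
  next
    fix x assume "x \<in> {real (deg F) / real (?M F) | F. integral_curve F \<and> zero_locus F \<inter> Sing H \<noteq> {}}"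
    then obtain F where F: "integral_curve F" "zero_locus F \<inter> Sing H \<noteq> {}"
      and x: "x = real (deg F) / real (?M F)" by blast
    define m where "m = ?M F"
    from bound[OF F] have "0 < m" "m \<le> (d - 1) * deg F"
      by (auto simp only: m_def)
    then have "real m \<le> real (d - 1) * real (deg F)"
      by (metis of_nat_le_iff of_nat_mult)
    with \<open>0 < m\<close> assms(1) show "1 / (real d - 1) \<le> x"
      unfolding x m_def[symmetric] by (simp add: of_nat_diff field_simps)
  qed
qed

end
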